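(* For every integer $k>1$, the group $$\Gamma_k=\langle a_1,\dots,a_k,t,p \mid a_1^t=a_1,\ a_i^t=a_ia_{i-1}\ (1<i\le k),\ [a_it,p]=1\ (1\le i\le k)\rangle$$ is not residually finite.
   Context: Conventions: $a^b:=b^{-1}ab$ and $[a,b]:=a^{-1}b^{-1}ab$. The hydra group is $G_k:=\langle a_1,\dots,a_k,t\mid a_1^t=a_1,\ a_i^t=a_ia_{i-1},\ 1<i\le k\rangle$, and $H_k:=\langle a_1t,\dots,a_kt\rangle\le G_k$. The group $\Gamma_k=\langle G_k,p\mid [a_it,p]=1,\ 1\le i\le k\rangle$ is the HNN extension of $G_k$ over $H_k$ with stable letter $p$ commuting with $H_k$. A group $G$ is residually finite if every $x\in G\setminus\{1\}$ has non-trivial image in some finite quotient of $G$. *)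

theory Defs
  imports "HOL-Algebra.Coset"
begin

section \<open>Group presentations\<close>

text \<open>A letter is a generator with an exponent sign: \<open>(x, True)\<close> stands for \<open>x\<close>,
  \<open>(x, False)\<close> for its inverse.\<close>

type_synonym 'a word = "('a \<times> bool) list"

definition words :: "'a set \<Rightarrow> 'a word set" where
  "words S = lists (S \<times> UNIV)"

definition gen :: "'a \<Rightarrow> 'a word" where
  "gen x = [(x, True)]"

definition winv :: "'a word \<Rightarrow> 'a word" where
  "winv w = rev (map (\<lambda>(x, b). (x, \<not> b)) w)"

text \<open>\<open>a\<^sup>b = b\<^sup>-\<^sup>1ab\<close> and \<open>[a, b] = a\<^sup>-\<^sup>1b\<^sup>-\<^sup>1ab\<close>\<close>

definition wconj :: "'a word \<Rightarrow> 'a word \<Rightarrow> 'a word" where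
  "wconj a b = winv b @ a @ b"

definition wcomm :: "'a word \<Rightarrow> 'a word \<Rightarrow> 'a word" where
  "wcomm a b = winv a @ winv b @ a @ b"

text \<open>A pair \<open>(r, s)\<close> in \<open>R\<close> is the defining relation \<open>r = s\<close>. Two words over \<open>S\<close> are related iff
  they represent the same element of \<open>\<langle>S | R\<rangle>\<close>.\<close>

inductive_set pres_rel :: "'a set \<Rightarrow> ('a word \<times> 'a word) set \<Rightarrow> ('a word \<times> 'a word) set"
  for S :: "'a set" and R :: "('a word \<times> 'a word) set" where
  refl: "u \<in> words S \<Longrightarrow> (u, u) \<in> pres_rel S R"
| sym: "(u, v) \<in> pres_rel S R \<Longrightarrow> (v, u) \<in> pres_rel S R"
| trans: "(u, v) \<in> pres_rel S R \<Longrightarrow> (v, w) \<in> pres_rel S R \<Longrightarrow> (u, w) \<in> pres_rel S R"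
| cancel: "x \<in> S \<Longrightarrow> u \<in> words S \<Longrightarrow> v \<in> words S
    \<Longrightarrow> (u @ [(x, b), (x, \<not> b)] @ v, u @ v) \<in> pres_rel S R"
| relation: "(r, s) \<in> R \<Longrightarrow> r \<in> words S \<Longrightarrow> s \<in> words S \<Longrightarrow> u \<in> words S \<Longrightarrow> v \<in> words S
    \<Longrightarrow> (u @ r @ v, u @ s @ v) \<in> pres_rel S R"

definition presented_group :: "'a set \<Rightarrow> ('a word \<times> 'a word) set \<Rightarrow> 'a word set monoid" where
  "presented_group S R =
    \<lparr> carrier = words S // pres_rel S R,
      monoid.mult = (\<lambda>X Y. \<Union>u\<in>X. \<Union>v\<in>Y. pres_rel S R `` {u @ v}),
      one = pres_rel S R `` {[]} \<rparr>"

lemma words_simps [simp]: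
  "[] \<in> words S"
  "u @ v \<in> words S \<longleftrightarrow> u \<in> words S \<and> v \<in> words S"
  "c # u \<in> words S \<longleftrightarrow> fst c \<in> S \<and> u \<in> words S"
  "winv u \<in> words S \<longleftrightarrow> u \<in> words S"
  by (cases c; auto simp: words_def winv_def in_lists_conv_set mem_Times_iff split_beta)+

lemma pres_rel_words:
  "(u, v) \<in> pres_rel S R \<Longrightarrow> u \<in> words S \<and> v \<in> words S"
  by (induction rule: pres_rel.induct) auto

lemma pres_rel_context:
  assumes "(u, v) \<in> pres_rel S R" "a \<in> words S" "b \<in> words S"
  shows "(a @ u @ b, a @ v @ b) \<in> pres_rel S R"
  using assms
proof (induction rule: pres_rel.induct)
  case (cancel x u v c)
  then show ?case using pres_rel.cancel[of x S "a @ u" "v @ b" c R] by simp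
next
  case (relation r s u v)
  then show ?case using pres_rel.relation[of r s R S "a @ u" "v @ b"] by simp
qed (auto intro: pres_rel.intros)

lemma pres_rel_append:
  assumes "(u, u') \<in> pres_rel S R" "(v, v') \<in> pres_rel S R"
  shows "(u @ v, u' @ v') \<in> pres_rel S R"
  using pres_rel_context[OF assms(1), of "[]" v] pres_rel_context[OF assms(2), of u' "[]"]
    pres_rel_words[OF assms(1)] pres_rel_words[OF assms(2)]
  by (auto intro: pres_rel.trans)

lemma pres_rel_winv_append:
  assumes "u \<in> words S"
  shows "(winv u @ u, []) \<in> pres_rel S R"
  using assms
proof (induction u)
  case (Cons c u)
  obtain x b where c: "c = (x, b)" by (cases c)
  have "(winv u @ [(x, \<not> b), (x, \<not> \<not> b)] @ u, winv u @ u) \<in> pres_rel S R"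
    using Cons.prems c by (intro pres_rel.cancel) auto
  moreover have "(winv u @ u, []) \<in> pres_rel S R" using Cons by simp
  ultimately show ?case by (auto simp: c winv_def intro: pres_rel.trans)
qed (auto simp: winv_def intro: pres_rel.refl)

lemma equiv_pres_rel: "equiv (words S) (pres_rel S R)"
proof (rule equivI)
  show "pres_rel S R \<subseteq> words S \<times> words S" using pres_rel_words[of _ _ S R] by auto
  show "refl_on (words S) (pres_rel S R)" by (simp add: refl_on_def pres_rel.refl)
  show "sym (pres_rel S R)" by (rule symI) (rule pres_rel.sym)
  show "trans (pres_rel S R)" by (rule transI) (rule pres_rel.trans)
qed

lemma presented_group_carrier:
  "X \<in> carrier (presented_group S R) \<longleftrightarrow> (\<exists>u\<in>words S. X = pres_rel S R `` {u})"
  by (auto simp: presented_group_def quotient_def)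

lemma presented_group_mult:
  assumes "u \<in> words S" "v \<in> words S"
  shows "pres_rel S R `` {u} \<otimes>\<^bsub>presented_group S R\<^esub> pres_rel S R `` {v}
    = pres_rel S R `` {u @ v}"
proof -
  have "pres_rel S R `` {u' @ v'} = pres_rel S R `` {u @ v}"
    if "(u, u') \<in> pres_rel S R" "(v, v') \<in> pres_rel S R" for u' v'
    using equiv_class_eq[OF equiv_pres_rel pres_rel_append[OF that]] by simp
  moreover have "u \<in> pres_rel S R `` {u}" "v \<in> pres_rel S R `` {v}"
    using assms by (auto intro: pres_rel.refl)
  ultimately have "(\<Union>u'\<in>pres_rel S R `` {u}. \<Union>v'\<in>pres_rel S R `` {v}. pres_rel S R `` {u' @ v'})
    = pres_rel S R `` {u @ v}" by blast
  then show ?thesis by (simp add: presented_group_def)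
qed

lemma presented_group_one: "\<one>\<^bsub>presented_group S R\<^esub> = pres_rel S R `` {[]}"
  by (simp add: presented_group_def)

lemma group_presented_group: "group (presented_group S R)"
proof (rule groupI)
  fix X assume "X \<in> carrier (presented_group S R)"
  then obtain u where u: "u \<in> words S" "X = pres_rel S R `` {u}"
    by (auto simp: presented_group_carrier)
  have "pres_rel S R `` {winv u} \<otimes>\<^bsub>presented_group S R\<^esub> X = \<one>\<^bsub>presented_group S R\<^esub>"
    using u equiv_class_eq[OF equiv_pres_rel pres_rel_winv_append[OF u(1)]]
    by (simp add: presented_group_mult presented_group_one)
  moreover have "pres_rel S R `` {winv u} \<in> carrier (presented_group S R)"
    using u by (auto simp: presented_group_carrier)
  ultimately show "\<exists>Y\<in>carrier (presented_group S R).
      Y \<otimes>\<^bsub>presented_group S R\<^esub> X = \<one>\<^bsub>presented_group S R\<^esub>" by blast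
next
  fix X Y assume "X \<in> carrier (presented_group S R)" "Y \<in> carrier (presented_group S R)"
  then obtain u v where "u \<in> words S" "X = pres_rel S R `` {u}"
    "v \<in> words S" "Y = pres_rel S R `` {v}"
    by (auto simp: presented_group_carrier)
  then show "X \<otimes>\<^bsub>presented_group S R\<^esub> Y \<in> carrier (presented_group S R)"
    by (auto simp: presented_group_mult presented_group_carrier intro!: bexI[of _ "u @ v"])
qed (auto simp: presented_group_mult presented_group_carrier presented_group_one
    intro!: bexI[of _ "[]"])

section \<open>The group \<open>\<Gamma>\<^sub>k\<close>\<close>

datatype hydra_gen = GenA nat | GenT | GenP

definition Gamma_gens :: "nat \<Rightarrow> hydra_gen set" where
  "Gamma_gens k = GenA ` {1..k} \<union> {GenT, GenP}"

definition Gamma_rels :: "nat \<Rightarrow> (hydra_gen word \<times> hydra_gen word) set" where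
  "Gamma_rels k =
    {(wconj (gen (GenA 1)) (gen GenT), gen (GenA 1))}
    \<union> {(wconj (gen (GenA i)) (gen GenT), gen (GenA i) @ gen (GenA (i - 1))) | i. 1 < i \<and> i \<le> k}
    \<union> {(wcomm (gen (GenA i) @ gen GenT) (gen GenP), []) | i. 1 \<le> i \<and> i \<le> k}"

definition Gamma :: "nat \<Rightarrow> hydra_gen word set monoid" where
  "Gamma k = presented_group (Gamma_gens k) (Gamma_rels k)"

text \<open>For \<open>k \<ge> 1\<close> no defining relation is discarded by the well-formedness premises
  of \<open>pres_rel\<close>.\<close>

lemma Gamma_rels_words:
  assumes "k \<ge> 1"
  shows "Gamma_rels k \<subseteq> words (Gamma_gens k) \<times> words (Gamma_gens k)"
  using assms
  by (auto simp: Gamma_rels_def Gamma_gens_def wconj_def wcomm_def gen_def intro!: imageI) arith+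

lemma group_Gamma: "group (Gamma k)"
  unfolding Gamma_def by (rule group_presented_group)

section \<open>Residual finiteness\<close>

definition residually_finite :: "('a, 'b) monoid_scheme \<Rightarrow> bool" where
  "residually_finite G \<longleftrightarrow>
    (\<forall>x \<in> carrier G - {\<one>\<^bsub>G\<^esub>}.
      \<exists>N. N \<lhd> G \<and> finite (carrier (G Mod N)) \<and> N #>\<^bsub>G\<^esub> x \<noteq> \<one>\<^bsub>G Mod N\<^esub>)"

end

theory Submission
  imports Defs "HOL-Algebra.Multiplicative_Group" "HOL-Library.Countable_Set"
begin

text \<open>Put \<open>g = a\<^sub>2\<^sup>-\<^sup>1ta\<^sub>1a\<^sub>2\<close>. In a finite quotient let \<open>C\<close> be the centraliser of \<open>p\<close>. The relations give
  \<open>a\<^sub>2\<^sup>-\<^sup>1t\<^sup>rC = t\<^sup>2\<^sup>r\<^sup>+\<^sup>1C\<close>, so the least \<open>m > 0\<close> with \<open>t\<^sup>m \<in> C\<close> is odd, say \<open>m = 2x + 1\<close>; then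
  \<open>a\<^sub>2 \<in> t\<^sup>xC\<close>, and \<open>g\<close> is conjugate to \<open>ta\<^sub>1 \<in> C\<close> by an element of \<open>C\<close>. Hence \<open>[g, p]\<close> dies in every
  finite quotient. To see that \<open>[g, p] \<noteq> 1\<close>, let \<open>G\<^sub>k\<close> act on a set so that a point is fixed by all
  \<open>a\<^sub>it\<close> but moved by \<open>g\<close>, and let \<open>p\<close> exchange the two copies of this point in two copies of the
  set. Such an action is extended from \<open>G\<^sub>k\<close> to \<open>G\<^sub>k\<^sub>+\<^sub>1\<close> by using that \<open>a\<^sub>k\<^sub>+\<^sub>1\<close> only has to
  conjugate \<open>ta\<^sub>k\<^sup>-\<^sup>1\<close> to \<open>t\<close>.\<close>

section \<open>Centralisers in finite groups\<close>

text \<open>Finiteness enters by putting some positive power of \<open>t\<close> into the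
  centraliser of \<open>p\<close>; the rest follows from the relations. In the application,
  \<open>a\<close> and \<open>b\<close> are the images of \<open>GenA 1\<close> and
  \<open>GenA 2\<close>.\<close>

lemma (in group) finite_hydra_commute:
  assumes fin: "finite (carrier G)"
    and a: "a \<in> carrier G" and b: "b \<in> carrier G" and t: "t \<in> carrier G" and p: "p \<in> carrier G"
    and at: "a \<otimes> t = t \<otimes> a" and bt: "b \<otimes> t = t \<otimes> (b \<otimes> a)"
    and atp: "(a \<otimes> t) \<otimes> p = p \<otimes> (a \<otimes> t)" and btp: "(b \<otimes> t) \<otimes> p = p \<otimes> (b \<otimes> t)"
  shows "(inv b \<otimes> t \<otimes> a \<otimes> b) \<otimes> p = p \<otimes> (inv b \<otimes> t \<otimes> a \<otimes> b)"
proof -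
  define C where "C = {x \<in> carrier G. x \<otimes> p = p \<otimes> x}"
  have C: "subgroup C G"
  proof (rule subgroupI)
    show "C \<subseteq> carrier G" by (auto simp: C_def)
    show "C \<noteq> {}" using p by (auto simp: C_def intro!: exI[of _ \<one>])
    show "inv x \<in> C" if "x \<in> C" for x
    proof -
      have x: "x \<in> carrier G" "x \<otimes> p = p \<otimes> x" using that by (auto simp: C_def)
      have "inv x \<otimes> p = inv x \<otimes> (p \<otimes> x) \<otimes> inv x" using x p by (simp add: m_assoc)
      also have "\<dots> = p \<otimes> inv x" using x p by (simp add: x(2)[symmetric] m_assoc[symmetric])
      finally show ?thesis using x by (simp add: C_def)
    qed
    show "x \<otimes> y \<in> C" if "x \<in> C" "y \<in> C" for x y
      using that p unfolding C_def by (auto simp: m_assoc) (metis m_assoc)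
  qed
  note Cc = subgroup.mem_carrier[OF C] and Cm = subgroup.m_closed[OF C]
    and Ci = subgroup.m_inv_closed[OF C]
  have ta: "t \<otimes> a \<in> C" using atp at a t by (simp add: C_def)
  have tb: "b \<otimes> t \<in> C" using btp b t by (simp add: C_def)
  have pow_ta: "t [^] n \<otimes> (t \<otimes> a) = (t \<otimes> a) \<otimes> t [^] n" for n :: nat
  proof (induction n)
    case (Suc n)
    have "t \<otimes> (t \<otimes> a) = (t \<otimes> a) \<otimes> t" using at a t by (simp add: m_assoc)
    then show ?case using Suc a t by simp (metis m_assoc m_closed nat_pow_closed)
  qed (use a t in simp)
  \<comment> \<open>The base case is \<open>b t\<close> in \<open>C\<close>. For the step,
    \<open>b^-1 t = t^2 z b^-1\<close>, where \<open>z = (t a)^-1\<close> lies in \<open>C\<close>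
    and commutes with \<open>t\<close>; so \<open>z\<close> moves to the right and is absorbed by
    \<open>C\<close>, and each further \<open>t\<close> becomes \<open>t^2\<close>.\<close>
  have shift: "\<exists>c\<in>C. inv b \<otimes> t [^] r = t [^] (2 * r + 1) \<otimes> c" for r :: nat
  proof (induction r)
    case 0
    have "inv b = t \<otimes> inv (b \<otimes> t)" using b t by (simp add: inv_mult_group m_assoc[symmetric])
    then show ?case using Ci[OF tb] b t by (intro bexI[of _ "inv (b \<otimes> t)"]) auto
  next
    case (Suc r)
    then obtain c where c: "c \<in> C" "inv b \<otimes> t [^] r = t [^] (2 * r + 1) \<otimes> c" by blast
    define z where "z = inv (t \<otimes> a)"
    have z: "z \<in> carrier G" "z \<in> C" using a t Ci[OF ta] by (auto simp: z_def)
    have zt: "z \<otimes> t [^] n = t [^] n \<otimes> z" for n :: nat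
      using pow_ta[of n] a t unfolding z_def
      by (metis inv_solve_left inv_solve_right m_assoc m_closed nat_pow_closed inv_closed)
    have ai: "inv a = t \<otimes> z" using a t by (simp add: z_def at[symmetric] inv_mult_group m_assoc[symmetric])
    have "inv b \<otimes> t = t \<otimes> (inv a \<otimes> inv b)"
    proof -
      have "b \<otimes> (t \<otimes> (inv a \<otimes> inv b)) = (b \<otimes> t) \<otimes> (inv a \<otimes> inv b)" using a b t by (simp add: m_assoc)
      also have "\<dots> = t \<otimes> (b \<otimes> (a \<otimes> (inv a \<otimes> inv b)))" using a b t unfolding bt by (simp add: m_assoc)
      also have "\<dots> = t" using a b t by (simp add: m_assoc[symmetric])
      finally show ?thesis using a b t by (metis inv_solve_left m_closed inv_closed)
    qed
    also have "\<dots> = t \<otimes> (t \<otimes> (z \<otimes> inv b))" using z b t by (simp add: ai m_assoc)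
    finally have bi: "inv b \<otimes> t = t \<otimes> (t \<otimes> (z \<otimes> inv b))" .
    have "inv b \<otimes> t [^] Suc r = (inv b \<otimes> t) \<otimes> t [^] r"
      using b t nat_pow_Suc2[of t r] by (simp add: m_assoc)
    also have "\<dots> = t \<otimes> (t \<otimes> (z \<otimes> (inv b \<otimes> t [^] r)))" using z b t by (simp add: bi m_assoc)
    also have "\<dots> = t \<otimes> (t \<otimes> ((z \<otimes> t [^] (2 * r + 1)) \<otimes> c))"
      unfolding c(2) using z t Cc[OF c(1)] by (simp add: m_assoc del: nat_pow_Suc)
    also have "\<dots> = t \<otimes> (t \<otimes> t [^] (2 * r + 1)) \<otimes> (z \<otimes> c)"
      unfolding zt using z t Cc[OF c(1)] by (simp add: m_assoc del: nat_pow_Suc)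
    also have "t \<otimes> (t \<otimes> t [^] (2 * r + 1)) = t [^] (2 * Suc r + 1)"
      unfolding nat_pow_Suc2[OF t, symmetric] by simp
    finally show ?case using Cm[OF z(2) c(1)] by blast
  qed
  define m where "m = (LEAST n :: nat. 0 < n \<and> t [^] n \<in> C)"
  have "0 < order G \<and> t [^] order G \<in> C"
    using fin t subgroup.one_closed[OF C] by (simp add: pow_order_eq_1 order_gt_0_iff_finite)
  then have "0 < m \<and> t [^] m \<in> C" unfolding m_def by (rule LeastI)
  then have m: "0 < m" "t [^] m \<in> C" by auto
  have least: "m \<le> n" if "0 < n" "t [^] n \<in> C" for n
    unfolding m_def using that by (simp add: Least_le)
  \<comment> \<open>If \<open>m = 2 r\<close>, then \<open>b^-1 t^r\<close> lies in
    \<open>t t^m C = t C\<close>, so \<open>t^r\<close> lies in \<open>b t C = C\<close>, against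
    the minimality of \<open>m\<close>.\<close>
  have "odd m"
  proof
    assume "even m"
    then obtain r where r: "m = 2 * r" by blast
    obtain c where c: "c \<in> C" "inv b \<otimes> t [^] r = t [^] (2 * r + 1) \<otimes> c" using shift by blast
    have "t [^] r = b \<otimes> (inv b \<otimes> t [^] r)" using b t by (simp add: m_assoc[symmetric])
    also have "\<dots> = b \<otimes> (t \<otimes> (t [^] m \<otimes> c))"
      using t Cc[OF c(1)] nat_pow_Suc2[OF t, of m] by (simp add: c(2) r m_assoc)
    also have "\<dots> = (b \<otimes> t) \<otimes> (t [^] m \<otimes> c)" using b t Cc[OF c(1)] by (simp add: m_assoc)
    finally have "t [^] r \<in> C" using Cm[OF tb Cm[OF m(2) c(1)]] by simp
    with least[of r] m(1) r show False by simp
  qed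
  then obtain x where x: "m = 2 * x + 1" by (rule oddE)
  obtain c where c: "c \<in> C" "inv b \<otimes> t [^] x = t [^] (2 * x + 1) \<otimes> c" using shift by blast
  \<comment> \<open>\<open>d\<close> lies in \<open>C\<close> because \<open>2 x + 1 = m\<close>. As
    \<open>t^x\<close> commutes with \<open>t a\<close>, substituting \<open>b = t^x d^-1\<close>
    turns the element into \<open>d (t a) d^-1\<close>.\<close>
  define d where "d = inv b \<otimes> t [^] x"
  have d: "d \<in> C" "d \<in> carrier G" using c Cm[OF m(2) c(1)] Cc by (auto simp: d_def x)
  have "inv b = d \<otimes> inv (t [^] x)" using b t by (simp add: d_def m_assoc)
  moreover from this have "b = t [^] x \<otimes> inv d"
    using b t d by (metis inv_inv inv_mult_group inv_closed nat_pow_closed)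
  moreover have "inv (t [^] x) \<otimes> ((t \<otimes> a) \<otimes> t [^] x) = t \<otimes> a"
    using a t by (simp add: pow_ta[symmetric] m_assoc[symmetric])
  ultimately have "inv b \<otimes> t \<otimes> a \<otimes> b = d \<otimes> (t \<otimes> a) \<otimes> inv d"
    using a t d by (smt (verit) m_assoc m_closed inv_closed nat_pow_closed)
  also have "\<dots> \<in> C" using d ta Ci Cm by auto
  finally show ?thesis by (simp add: C_def)
qed

section \<open>Permutation actions of the hydra group\<close>

text \<open>Avoids the clash between inverse functions and inverses of group elements.\<close>

abbreviation finv :: "('a \<Rightarrow> 'b) \<Rightarrow> 'b \<Rightarrow> 'a" where
  "finv \<equiv> inv_into UNIV"

text \<open>The distinguished point is \<open>\<psi> 0\<close> and \<open>\<psi>\<close> parametrises its orbit under \<open>t\<close>. The growth condition on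
  \<open>a k\<close> is what makes the orbit of \<open>\<psi> 1\<close> under \<open>t (a k)\<^sup>-\<^sup>1\<close> infinite in the inductive step.\<close>

definition hydra_action :: "nat \<Rightarrow> ('y \<Rightarrow> 'y) \<Rightarrow> (nat \<Rightarrow> 'y \<Rightarrow> 'y) \<Rightarrow> (int \<Rightarrow> 'y) \<Rightarrow> bool" where
  "hydra_action k t a \<psi> \<longleftrightarrow>
    bij t \<and> (\<forall>i\<in>{1..k}. bij (a i) \<and> a i (\<psi> 1) = \<psi> 0) \<and> (\<forall>y. a 1 (t y) = t (a 1 y)) \<and>
    (\<forall>i\<in>{1<..k}. \<forall>y. a i (t y) = t (a i (a (i - 1) y))) \<and>
    inj \<psi> \<and> (\<forall>n. t (\<psi> n) = \<psi> (n + 1)) \<and> (\<forall>r\<ge>0. \<exists>s>r. a k (\<psi> s) = \<psi> r) \<and>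
    t (a 1 (a 2 (\<psi> 0))) \<noteq> a 2 (\<psi> 0)"

text \<open>Each inductive step enlarges the underlying type; transport back to \<open>nat\<close>
  keeps the type fixed along the induction.\<close>

lemma hydra_action_transport:
  fixes e :: "'y \<Rightarrow> 'z"
  assumes e: "bij e" and act: "hydra_action k t a \<psi>"
  shows "hydra_action k (e \<circ> t \<circ> finv e) (\<lambda>i. e \<circ> a i \<circ> finv e) (e \<circ> \<psi>)"
  using act e unfolding hydra_action_def
  by (auto simp: bij_comp bij_imp_bij_inv inj_compose bij_is_inj inv_f_f inj_eq)

text \<open>Row 0 is the \<open>t\<close>-orbit of the distinguished point. There \<open>a 1\<close>
  is \<open>t^-1\<close>, and \<open>a 2\<close> sends \<open>2 r + 1\<close> to \<open>r\<close>,
  mirroring \<open>b^-1 t^r C = t^(2 r + 1) C\<close>. The even points go onto row 1, and all rows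
  from 1 on move up to make room. The point \<open>a 2 (\<psi> 0)\<close> lies in row 1, which
  \<open>a 1\<close> fixes and \<open>t\<close> shifts.\<close>

lemma hydra_action_2:
  "hydra_action 2 (\<lambda>(r, j). (r + 1, j))
     (\<lambda>i (r, j). if i = 1 then (if j = 0 then r - 1 else r, j)
       else if j = 0 then (r div 2, if odd r then 0 else 1) else (r, Suc j))
     (\<lambda>r. (r, 0 :: nat))"
    (is "hydra_action 2 ?t ?a ?\<psi>")
proof -
  have "bij ?t"
    by (rule o_bij[of "\<lambda>(r, j). (r - 1, j)"]) auto
  moreover have "bij (?a 1)"
    by (rule o_bij[of "\<lambda>(r, j). (if j = 0 then r + 1 else r, j)"]) (auto simp: fun_eq_iff)
  moreover have "bij (?a 2)"
    by (rule o_bij[of "\<lambda>(r, j). if j = 0 then (2 * r + 1, 0) else if j = 1 then (2 * r, 0) else (r, j - 1)"])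
      (auto simp: fun_eq_iff elim: oddE)
  moreover have "\<exists>s>r. ?a 2 (?\<psi> s) = ?\<psi> r" if "r \<ge> 0" for r
    using that by (intro exI[of _ "2 * r + 1"]) auto
  moreover have "{1..2} = {1, 2 :: nat}" "{1<..2} = {2 :: nat}" by auto
  ultimately show ?thesis unfolding hydra_action_def
    by (auto simp: inj_def elim: oddE)
qed

lemma bij_int_orbit:
  assumes "bij u"
  shows "\<exists>\<phi> :: int \<Rightarrow> 'y. \<phi> 0 = x \<and> (\<forall>n. u (\<phi> n) = \<phi> (n + 1))"
proof -
  define \<phi> where "\<phi> n = (if n \<ge> 0 then (u ^^ nat n) x else (finv u ^^ nat (- n)) x)" for n :: int
  have "\<phi> 0 = x" by (simp add: \<phi>_def)
  moreover have "u (\<phi> n) = \<phi> (n + 1)" for n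
  proof (cases "n \<ge> 0")
    case True
    then show ?thesis by (simp add: \<phi>_def nat_add_distrib)
  next
    case False
    then have "nat (- n) = Suc (nat (- (n + 1)))" by simp
    then have "u (\<phi> n) = (finv u ^^ nat (- (n + 1))) x"
      using False assms by (simp add: \<phi>_def bij_inv_eq_iff[symmetric] bij_is_surj surj_f_inv_f)
    then show ?thesis using False by (cases "n = -1") (auto simp: \<phi>_def)
  qed
  ultimately show ?thesis by blast
qed

text \<open>The new generator must map the \<open>u\<close>-orbit \<open>D\<close> of \<open>\<psi> 1\<close>, where \<open>u = t (a k)\<^sup>-\<^sup>1\<close>, to the \<open>t\<close>-orbit \<open>R\<close>
  of \<open>\<psi> 0\<close>. An Eilenberg swindle completes this to a conjugation of \<open>u\<close> to \<open>t\<close>: infinitely many copies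
  of the set are added on which the old generators act trivially and \<open>t\<close> acts as \<open>u\<close> (positive levels) or
  as \<open>t\<close> (negative levels), and the new generator raises the level by one outside \<open>D\<close> and \<open>R\<close>.\<close>

lemma hydra_action_Suc:
  fixes t :: "'y \<Rightarrow> 'y"
  assumes act: "hydra_action k t a \<psi>" and k: "k \<ge> 2"
  shows "\<exists>t' a' \<psi>'. hydra_action (Suc k) (t' :: 'y \<times> int \<Rightarrow> 'y \<times> int) a' \<psi>'"
proof -
  have bt: "bij t" and ba: "\<And>i. i \<in> {1..k} \<Longrightarrow> bij (a i)"
    and a\<psi>: "\<And>i. i \<in> {1..k} \<Longrightarrow> a i (\<psi> 1) = \<psi> 0"
    and a1: "\<And>y. a 1 (t y) = t (a 1 y)"
    and rel: "\<And>i y. i \<in> {1<..k} \<Longrightarrow> a i (t y) = t (a i (a (i - 1) y))"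
    and inj: "inj \<psi>" and t\<psi>: "\<And>n. t (\<psi> n) = \<psi> (n + 1)"
    and grow: "\<And>r. r \<ge> 0 \<Longrightarrow> \<exists>s>r. a k (\<psi> s) = \<psi> r"
    and move: "t (a 1 (a 2 (\<psi> 0))) \<noteq> a 2 (\<psi> 0)"
    using act by (simp_all add: hydra_action_def)
  define u where "u = t \<circ> finv (a k)"
  have bk: "bij (a k)" using ba k by simp
  have bu: "bij u" unfolding u_def using bt bk by (intro bij_comp bij_imp_bij_inv)
  have ua: "u (a k y) = t y" for y using bk by (simp add: u_def bij_is_inj)
  obtain \<phi> :: "int \<Rightarrow> 'y" where \<phi>: "\<phi> 0 = \<psi> 1 \<and> (\<forall>n. u (\<phi> n) = \<phi> (n + 1))"
    using bij_int_orbit[OF bu, of "\<psi> 1"] ..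
  then have \<phi>0: "\<phi> 0 = \<psi> 1" and u\<phi>: "\<And>n. u (\<phi> n) = \<phi> (n + 1)" by auto
  \<comment> \<open>By the growth condition \<open>\<psi> s = a k (\<psi> s')\<close> with
    \<open>s' > s\<close>, and \<open>u\<close> sends this to
    \<open>t (\<psi> s') = \<psi> (s' + 1)\<close>: the forward half of the \<open>u\<close>-orbit
    runs along \<psi> with increasing indices.\<close>
  have \<phi>\<psi>: "\<exists>s > int n. \<phi> (int n) = \<psi> s" for n
  proof (induction n)
    case (Suc n)
    then obtain s where s: "s > int n" "\<phi> (int n) = \<psi> s" by blast
    obtain s' where s': "s' > s" "a k (\<psi> s') = \<psi> s" using grow[of s] s(1) by fastforce
    have "\<phi> (int (Suc n)) = \<psi> (s' + 1)"
      using u\<phi>[of "int n"] ua[of "\<psi> s'"] t\<psi>[of s'] unfolding s(2) s'(2) of_nat_Suc by (simp only: add.commute)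
    then show ?case using s(1) s'(1) by (intro exI[of _ "s' + 1"]) auto
  qed (simp add: \<phi>0, intro exI[of _ 1], simp)
  \<comment> \<open>A coincidence spreads along the orbit in both directions, since \<open>u\<close>
    is bijective. At index 0 it makes \<open>\<psi> 1\<close> equal to some \<open>\<psi> q\<close>
    with \<open>q > 1\<close>.\<close>
  have \<phi>_ne: "\<phi> m \<noteq> \<phi> (m + int (Suc d))" for m d
  proof
    assume eq: "\<phi> m = \<phi> (m + int (Suc d))"
    have "\<phi> i = \<phi> (i + int (Suc d))" for i
    proof (induction i rule: int_induct[where k = m])
      case (step1 i)
      then show ?case using u\<phi>[of i] u\<phi>[of "i + int (Suc d)"] by (simp add: add_ac)
    next
      case (step2 i)
      then have "u (\<phi> (i - 1)) = u (\<phi> (i - 1 + int (Suc d)))"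
        by (simp add: u\<phi> algebra_simps)
      then show ?case using bu by (simp add: bij_is_inj inj_eq)
    qed (rule eq)
    from this[of 0] have "\<psi> 1 = \<phi> (int (Suc d))" using \<phi>0 by simp
    moreover obtain q where "q > int (Suc d)" "\<phi> (int (Suc d)) = \<psi> q" using \<phi>\<psi> by blast
    ultimately show False using inj by (auto simp: inj_eq)
  qed
  have inj\<phi>: "inj \<phi>"
  proof (rule injI, rule ccontr)
    fix m n assume eq: "\<phi> m = \<phi> n" and "m \<noteq> n"
    then consider "m < n" | "n < m" by linarith
    then show False
      by cases (use eq \<phi>_ne[of m "nat (n - m - 1)"] \<phi>_ne[of n "nat (m - n - 1)"] in auto)
  qed
  define D where "D = range \<phi>"
  define R where "R = range \<psi>"
  \<comment> \<open>\<alpha> and \<beta> match \<open>\<phi> n\<close> with \<open>\<psi> n\<close>,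
    hence intertwine \<open>u\<close> on \<open>D\<close> with \<open>t\<close> on
    \<open>R\<close>.\<close>
  define \<alpha> where "\<alpha> = \<psi> \<circ> finv \<phi>"
  define \<beta> where "\<beta> = \<phi> \<circ> finv \<psi>"
  have uD: "u y \<in> D \<longleftrightarrow> y \<in> D" for y
  proof
    assume "u y \<in> D"
    then obtain n where "u y = u (\<phi> (n - 1))" by (auto simp: D_def u\<phi>)
    then show "y \<in> D" using bu by (auto simp: D_def dest: injD[OF bij_is_inj])
  qed (auto simp: D_def u\<phi>)
  have tR: "t y \<in> R \<longleftrightarrow> y \<in> R" for y
  proof
    assume "t y \<in> R"
    then obtain n where "t y = t (\<psi> (n - 1))" by (auto simp: R_def t\<psi>)
    then show "y \<in> R" using bt by (auto simp: R_def dest: injD[OF bij_is_inj])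
  qed (auto simp: R_def t\<psi>)
  have \<phi>D: "\<phi> n \<in> D" and \<alpha>\<phi>: "\<alpha> (\<phi> n) = \<psi> n" for n
    using inj\<phi> by (auto simp: D_def \<alpha>_def)
  have \<alpha>u: "\<alpha> (u y) = t (\<alpha> y)" if "y \<in> D" for y
    using that inj\<phi> by (auto simp: D_def \<alpha>_def u\<phi> t\<psi>)
  have \<alpha>\<beta>: "y \<in> D \<Longrightarrow> \<alpha> y \<in> R" "y \<in> R \<Longrightarrow> \<beta> y \<in> D" "y \<in> D \<Longrightarrow> \<beta> (\<alpha> y) = y" "y \<in> R \<Longrightarrow> \<alpha> (\<beta> y) = y" for y
    using inj\<phi> inj by (auto simp: D_def R_def \<alpha>_def \<beta>_def)
  define t' where "t' = (\<lambda>(y, n :: int). (if n > 0 then u y else t y, n))"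
  define s where "s = (\<lambda>(y, n :: int).
    if n > 0 then (y, if y \<in> D then n else n + 1)
    else if n = 0 then (if y \<in> D then (\<alpha> y, 0) else (y, 1))
    else (y, if y \<in> R then n else n + 1))"
  define a' where "a' i = (if i = Suc k then s else (\<lambda>(y, n :: int). (if n = 0 then a i y else y, n)))" for i
  define \<psi>' where "\<psi>' n = (\<psi> n, 0 :: int)" for n
  have bt': "bij t'"
    by (rule o_bij[of "\<lambda>(y, n). (if n > 0 then finv u y else finv t y, n)"])
      (auto simp: t'_def fun_eq_iff bu bt bij_is_inj bij_is_surj surj_f_inv_f)
  \<comment> \<open>Level 0 is covered by \<alpha>, which fills \<open>R\<close>, and by the points
    outside \<open>R\<close> raised from level -1.\<close>
  have bs: "bij s"
    by (rule o_bij[of "\<lambda>(y, n). if n > 0 then (y, if y \<in> D then n else n - 1)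
        else if n = 0 then (if y \<in> R then (\<beta> y, 0) else (y, -1))
        else (y, if y \<in> R then n else n - 1)"])
      (auto simp: s_def fun_eq_iff \<alpha>\<beta>)
  have ba': "bij (a' i)" if "i \<in> {1..Suc k}" for i
  proof (cases "i = Suc k")
    case False
    then have "bij (a i)" using that ba by simp
    then show ?thesis using False
      by (intro o_bij[of "\<lambda>(y, n). (if n = 0 then finv (a i) y else y, n)"])
        (auto simp: a'_def fun_eq_iff bij_is_inj bij_is_surj surj_f_inv_f)
  qed (simp add: a'_def bs)
  \<comment> \<open>For the new generator this is \<open>\<alpha> (\<phi> 0) = \<psi> 0\<close>,
    which is why \<phi> starts at \<open>\<psi> 1\<close>.\<close>
  have a\<psi>': "a' i (\<psi>' 1) = \<psi>' 0" if "i \<in> {1..Suc k}" for i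
    using that a\<psi>[of i] \<phi>D[of 0] \<alpha>\<phi>[of 0] by (auto simp: a'_def \<psi>'_def s_def \<phi>0)
  \<comment> \<open>That is, \<open>s\<close> conjugates \<open>t' (a' k)^-1\<close> to
    \<open>t'\<close>. These two maps differ only at level 0, where the first acts as
    \<open>u\<close> and the second as \<open>t\<close>; \<open>s\<close> leads from there to
    \<open>R\<close> via \<alpha> or to level 1, where \<open>t'\<close> acts as
    \<open>u\<close>.\<close>
  have "s (t' (y, n)) = t' (s (a' k (y, n)))" for y n
  proof (cases "n = 0")
    case True
    then show ?thesis
      using \<alpha>u[of "a k y"] uD[of "a k y"] by (auto simp: s_def a'_def t'_def ua)
  qed (auto simp: s_def a'_def t'_def uD tR)
  then have rel': "a' i (t' z) = t' (a' i (a' (i - 1) z))" if "i \<in> {1<..Suc k}" for i z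
    using that rel[of i] k by (cases z; cases "i = Suc k") (auto simp: a'_def t'_def)
  have a1': "a' 1 (t' z) = t' (a' 1 z)" for z
    using k a1 by (cases z) (auto simp: a'_def t'_def)
  \<comment> \<open>The new generator sends \<open>\<phi> r\<close> to \<open>\<psi> r\<close>, and
    \<open>\<phi> r\<close> is some \<open>\<psi> q\<close> with \<open>q > r\<close>.\<close>
  have grow': "\<exists>s>r. a' (Suc k) (\<psi>' s) = \<psi>' r" if r: "r \<ge> 0" for r
  proof -
    obtain q where "q > r" "\<phi> r = \<psi> q" using \<phi>\<psi>[of "nat r"] r by auto
    then show ?thesis
      using \<phi>D[of r] \<alpha>\<phi>[of r] by (intro exI[of _ q]) (auto simp: a'_def \<psi>'_def s_def)
  qed
  have "t' (a' 1 (a' 2 (\<psi>' 0))) \<noteq> a' 2 (\<psi>' 0)"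
    using k move by (auto simp: a'_def \<psi>'_def t'_def)
  moreover have "inj \<psi>'" using inj by (auto simp: inj_def \<psi>'_def)
  moreover have "t' (\<psi>' n) = \<psi>' (n + 1)" for n by (simp add: t'_def \<psi>'_def t\<psi>)
  ultimately have "hydra_action (Suc k) t' a' \<psi>'"
    unfolding hydra_action_def using bt' ba' a\<psi>' a1' rel' grow' by blast
  then show ?thesis by blast
qed

lemma hydra_action_exists:
  assumes "k \<ge> 2"
  shows "\<exists>t a \<psi>. hydra_action k (t :: nat \<Rightarrow> nat) a \<psi>"
  using assms
proof (induction k rule: dec_induct)
  case base
  have "bij (to_nat_on (UNIV :: (int \<times> nat) set))"
    by (intro bij_betw_from_nat_into to_nat_on_infinite) (auto simp: finite_prod)
  then show ?case using hydra_action_transport[OF _ hydra_action_2] by blast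
next
  case (step k)
  have "bij (to_nat_on (UNIV :: (nat \<times> int) set))"
    by (intro to_nat_on_infinite) (auto simp: finite_prod)
  then show ?case using step hydra_action_Suc hydra_action_transport by metis
qed

section \<open>Evaluating words, and a criterion against residual finiteness\<close>

fun eval_word :: "('a \<Rightarrow> 'z \<Rightarrow> 'z) \<Rightarrow> 'a word \<Rightarrow> 'z \<Rightarrow> 'z" where
  "eval_word f [] = id"
| "eval_word f ((x, b) # w) = (if b then f x else finv (f x)) \<circ> eval_word f w"

lemma eval_word_append: "eval_word f (u @ v) = eval_word f u \<circ> eval_word f v"
  by (induction f u rule: eval_word.induct) auto

text \<open>Permutations satisfying the defining relations give an action of the presented group, so
  words with different evaluations represent different elements.\<close>

lemma eval_word_pres_rel:
  assumes "(u, v) \<in> pres_rel S R" and bij: "\<And>x. x \<in> S \<Longrightarrow> bij (f x)"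
    and rel: "\<And>r s. (r, s) \<in> R \<Longrightarrow> eval_word f r = eval_word f s"
  shows "eval_word f u = eval_word f v"
  using assms(1)
proof (induction rule: pres_rel.induct)
  case (cancel x u v b)
  then show ?case using bij[of x]
    by (auto simp: eval_word_append fun_eq_iff bij_is_inj bij_is_surj surj_f_inv_f)
qed (auto simp: eval_word_append rel)

text \<open>The element that no finite quotient detects is \<open>x y^-1\<close>. Having two
  elements allows \<open>[g, p]\<close> to be treated through the equation
  \<open>g p = p g\<close>.\<close>

lemma not_residually_finiteI:
  assumes G: "group G" and x: "x \<in> carrier G" and y: "y \<in> carrier G" and ne: "x \<noteq> y"
    and quot: "\<And>N. N \<lhd> G \<Longrightarrow> finite (carrier (G Mod N)) \<Longrightarrow> N #>\<^bsub>G\<^esub> x = N #>\<^bsub>G\<^esub> y"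
  shows "\<not> residually_finite G"
proof
  interpret group G by fact
  assume "residually_finite G"
  moreover have "x \<otimes>\<^bsub>G\<^esub> inv\<^bsub>G\<^esub> y \<in> carrier G - {\<one>\<^bsub>G\<^esub>}"
    using x y ne by (auto dest: inv_equality simp: inv_equality)
  ultimately obtain N where N: "N \<lhd> G" "finite (carrier (G Mod N))"
    "N #>\<^bsub>G\<^esub> (x \<otimes>\<^bsub>G\<^esub> inv\<^bsub>G\<^esub> y) \<noteq> \<one>\<^bsub>G Mod N\<^esub>" unfolding residually_finite_def by blast
  interpret normal N G by fact
  have "N #>\<^bsub>G\<^esub> (x \<otimes>\<^bsub>G\<^esub> inv\<^bsub>G\<^esub> y) = N #>\<^bsub>G\<^esub> x #>\<^bsub>G\<^esub> inv\<^bsub>G\<^esub> y"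
    using x y subset by (simp add: coset_mult_assoc)
  also have "\<dots> = N"
    using quot[OF N(1,2)] x y subset by (simp add: coset_mult_assoc)
  finally show False using N(3) by (simp add: FactGroup_def)
qed

section \<open>Relations, finite quotients and a permutation action of
  \<open>Gamma k\<close>\<close>

theorem theorem1p1:
  fixes k :: nat
  assumes "k > 1"
  shows "\<not> residually_finite (Gamma k)"
proof -
  interpret group "Gamma k" by (rule group_Gamma)
  let ?G = "Gamma k"
  let ?S = "Gamma_gens k" and ?R = "Gamma_rels k"
  define cls where "cls w = pres_rel ?S ?R `` {w}" for w
  have cls_carrier: "cls w \<in> carrier ?G" if "w \<in> words ?S" for w
    using that by (auto simp: Gamma_def presented_group_carrier cls_def)
  have cls_append: "cls (u @ v) = cls u \<otimes>\<^bsub>?G\<^esub> cls v" if "u \<in> words ?S" "v \<in> words ?S" for u v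
    using that by (simp add: Gamma_def presented_group_mult cls_def)
  have cls_Nil: "cls [] = \<one>\<^bsub>?G\<^esub>" by (simp add: Gamma_def presented_group_one cls_def)
  have cls_eq: "cls u = cls v \<longleftrightarrow> (u, v) \<in> pres_rel ?S ?R" if "u \<in> words ?S" "v \<in> words ?S" for u v
    using that by (simp add: cls_def eq_equiv_class_iff[OF equiv_pres_rel])
  have cls_winv: "cls (winv w) = inv\<^bsub>?G\<^esub> cls w" if "w \<in> words ?S" for w
    using that cls_append[of "winv w" w] cls_eq[of "winv w @ w" "[]"] pres_rel_winv_append[of w ?S ?R]
    by (intro inv_equality[symmetric]) (auto simp: cls_carrier cls_Nil)
  have cls_rel: "cls r = cls s" if "(r, s) \<in> ?R" for r s
    using that Gamma_rels_words[of k] assms pres_rel.relation[of r s ?R ?S "[]" "[]"]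
    by (subst cls_eq) auto
  have gens: "gen (GenA i) \<in> words ?S" if "1 \<le> i" "i \<le> k" for i
    using that by (auto simp: gen_def Gamma_gens_def)
  have genT: "gen GenT \<in> words ?S" and genP: "gen GenP \<in> words ?S"
    by (auto simp: gen_def Gamma_gens_def)
  define a where "a = cls (gen (GenA 1))"
  define b where "b = cls (gen (GenA 2))"
  define t where "t = cls (gen GenT)"
  define p where "p = cls (gen GenP)"
  have gens12: "gen (GenA 1) \<in> words ?S" "gen (GenA 2) \<in> words ?S" using gens assms by auto
  have carr [simp]: "a \<in> carrier ?G" "b \<in> carrier ?G" "t \<in> carrier ?G" "p \<in> carrier ?G"
    using gens12 genT genP by (auto simp: a_def b_def t_def p_def cls_carrier)
  note ws = gens12 genT genP
  have conj_rel: "y \<otimes>\<^bsub>?G\<^esub> x = x \<otimes>\<^bsub>?G\<^esub> z" if "inv\<^bsub>?G\<^esub> x \<otimes>\<^bsub>?G\<^esub> (y \<otimes>\<^bsub>?G\<^esub> x) = z"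
    "x \<in> carrier ?G" "y \<in> carrier ?G" for x y z
    using that by (auto simp: m_assoc[symmetric])
  have comm_rel: "x \<otimes>\<^bsub>?G\<^esub> p = p \<otimes>\<^bsub>?G\<^esub> x"
    if "inv\<^bsub>?G\<^esub> x \<otimes>\<^bsub>?G\<^esub> (inv\<^bsub>?G\<^esub> p \<otimes>\<^bsub>?G\<^esub> (x \<otimes>\<^bsub>?G\<^esub> p)) = \<one>\<^bsub>?G\<^esub>" "x \<in> carrier ?G" for x
  proof -
    have "inv\<^bsub>?G\<^esub> p \<otimes>\<^bsub>?G\<^esub> (x \<otimes>\<^bsub>?G\<^esub> p) = x"
      using that by (metis carr(4) inv_closed inv_inv inv_equality m_closed inv_comm)
    then show ?thesis using that by (intro conj_rel) auto
  qed
  have "cls (wconj (gen (GenA 1)) (gen GenT)) = a"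
    unfolding a_def by (rule cls_rel) (simp add: Gamma_rels_def)
  then have at: "a \<otimes>\<^bsub>?G\<^esub> t = t \<otimes>\<^bsub>?G\<^esub> a"
    using ws by (intro conj_rel) (auto simp: wconj_def cls_append cls_winv cls_carrier a_def t_def)
  have "cls (wconj (gen (GenA 2)) (gen GenT)) = cls (gen (GenA 2) @ gen (GenA (2 - 1)))"
    by (rule cls_rel) (use assms in \<open>auto simp: Gamma_rels_def\<close>)
  then have bt: "b \<otimes>\<^bsub>?G\<^esub> t = t \<otimes>\<^bsub>?G\<^esub> (b \<otimes>\<^bsub>?G\<^esub> a)"
    using ws by (intro conj_rel) (auto simp: wconj_def cls_append cls_winv cls_carrier a_def b_def t_def)
  have comm: "cls (wcomm (gen (GenA i) @ gen GenT) (gen GenP)) = cls []" if "1 \<le> i" "i \<le> k" for i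
    by (rule cls_rel) (use that in \<open>auto simp: Gamma_rels_def\<close>)
  have atp: "(a \<otimes>\<^bsub>?G\<^esub> t) \<otimes>\<^bsub>?G\<^esub> p = p \<otimes>\<^bsub>?G\<^esub> (a \<otimes>\<^bsub>?G\<^esub> t)"
    using ws comm[of 1] assms
    by (intro comm_rel) (auto simp: wcomm_def cls_append cls_winv cls_Nil cls_carrier a_def t_def p_def m_assoc)
  have btp: "(b \<otimes>\<^bsub>?G\<^esub> t) \<otimes>\<^bsub>?G\<^esub> p = p \<otimes>\<^bsub>?G\<^esub> (b \<otimes>\<^bsub>?G\<^esub> t)"
    using ws comm[of 2] assms
    by (intro comm_rel) (auto simp: wcomm_def cls_append cls_winv cls_Nil cls_carrier b_def t_def p_def m_assoc)
  let ?g = "inv\<^bsub>?G\<^esub> b \<otimes>\<^bsub>?G\<^esub> t \<otimes>\<^bsub>?G\<^esub> a \<otimes>\<^bsub>?G\<^esub> b"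
  let ?w = "winv (gen (GenA 2)) @ gen GenT @ gen (GenA 1) @ gen (GenA 2)"
  note closed = m_closed inv_closed
  have quot: "N #>\<^bsub>?G\<^esub> (?g \<otimes>\<^bsub>?G\<^esub> p) = N #>\<^bsub>?G\<^esub> (p \<otimes>\<^bsub>?G\<^esub> ?g)"
    if N: "N \<lhd> ?G" and fin: "finite (carrier (?G Mod N))" for N
  proof -
    interpret normal N ?G by fact
    interpret Q: group "?G Mod N" by (rule factorgroup_is_group)
    define h where "h x = N #>\<^bsub>?G\<^esub> x" for x
    interpret h: group_hom ?G "?G Mod N" h
      unfolding h_def by unfold_locales (rule r_coset_hom_Mod)
    \<comment> \<open>Read backwards, the homomorphism laws fold an expression in images into the
      image of a single element, where the relations of \<open>Gamma k\<close> apply.\<close>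
    note map = h.hom_mult[symmetric] h.hom_inv[symmetric]
    have "(inv\<^bsub>?G Mod N\<^esub> h b \<otimes>\<^bsub>?G Mod N\<^esub> h t \<otimes>\<^bsub>?G Mod N\<^esub> h a \<otimes>\<^bsub>?G Mod N\<^esub> h b) \<otimes>\<^bsub>?G Mod N\<^esub> h p
      = h p \<otimes>\<^bsub>?G Mod N\<^esub> (inv\<^bsub>?G Mod N\<^esub> h b \<otimes>\<^bsub>?G Mod N\<^esub> h t \<otimes>\<^bsub>?G Mod N\<^esub> h a \<otimes>\<^bsub>?G Mod N\<^esub> h b)"
    proof (rule Q.finite_hydra_commute[OF fin])
      show "h a \<otimes>\<^bsub>?G Mod N\<^esub> h t = h t \<otimes>\<^bsub>?G Mod N\<^esub> h a"
        by (simp only: map carr at)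
      show "h b \<otimes>\<^bsub>?G Mod N\<^esub> h t = h t \<otimes>\<^bsub>?G Mod N\<^esub> (h b \<otimes>\<^bsub>?G Mod N\<^esub> h a)"
        by (simp only: map carr closed bt)
      show "h a \<otimes>\<^bsub>?G Mod N\<^esub> h t \<otimes>\<^bsub>?G Mod N\<^esub> h p = h p \<otimes>\<^bsub>?G Mod N\<^esub> (h a \<otimes>\<^bsub>?G Mod N\<^esub> h t)"
        by (simp only: map carr closed atp)
      show "h b \<otimes>\<^bsub>?G Mod N\<^esub> h t \<otimes>\<^bsub>?G Mod N\<^esub> h p = h p \<otimes>\<^bsub>?G Mod N\<^esub> (h b \<otimes>\<^bsub>?G Mod N\<^esub> h t)"
        by (simp only: map carr closed btp)
    qed (rule h.hom_closed, rule carr)+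
    then have "h (?g \<otimes>\<^bsub>?G\<^esub> p) = h (p \<otimes>\<^bsub>?G\<^esub> ?g)"
      by (simp only: map carr closed)
    then show ?thesis by (simp only: h_def)
  qed
  obtain T A \<psi> where act: "hydra_action k (T :: nat \<Rightarrow> nat) A \<psi>"
    using hydra_action_exists[of k] assms by auto
  define f where "f x = (case x of GenA i \<Rightarrow> map_prod (A i) id | GenT \<Rightarrow> map_prod T id
    | GenP \<Rightarrow> (\<lambda>(y, c). (y, if y = \<psi> 0 then \<not> c else c)))" for x
  have T: "bij T" and A: "\<And>i. 1 \<le> i \<Longrightarrow> i \<le> k \<Longrightarrow> bij (A i)"
    and A\<psi>: "\<And>i. 1 \<le> i \<Longrightarrow> i \<le> k \<Longrightarrow> A i (\<psi> 1) = \<psi> 0"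
    and A1: "\<And>y. A 1 (T y) = T (A 1 y)"
    and Ai: "\<And>i y. 1 < i \<Longrightarrow> i \<le> k \<Longrightarrow> A i (T y) = T (A i (A (i - 1) y))"
    and T\<psi>: "\<And>n. T (\<psi> n) = \<psi> (n + 1)"
    and move: "T (A 1 (A 2 (\<psi> 0))) \<noteq> A 2 (\<psi> 0)"
    using act by (simp_all add: hydra_action_def)
  have f_simps: "f (GenA i) (y, c) = (A i y, c)" "f GenT (y, c) = (T y, c)"
    "f GenP (y, c) = (y, if y = \<psi> 0 then \<not> c else c)" for i y c
    by (auto simp: f_def)
  have bij_f: "bij (f x)" if x: "x \<in> ?S" for x
  proof (cases x)
    case (GenA i)
    then have "bij (A i)" using x A by (auto simp: Gamma_gens_def)
    then show ?thesis unfolding GenA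
      by (intro o_bij[of "map_prod (finv (A i)) id"])
        (auto simp: fun_eq_iff f_simps bij_is_inj bij_is_surj surj_f_inv_f)
  next
    case GenT
    show ?thesis unfolding GenT
      by (rule o_bij[of "map_prod (finv T) id"])
        (auto simp: fun_eq_iff f_simps T bij_is_inj bij_is_surj surj_f_inv_f)
  next
    case GenP
    show ?thesis unfolding GenP
      by (rule o_bij[of "f GenP"]) (auto simp: fun_eq_iff f_simps)
  qed
  then have f_inv: "finv (f x) z = w \<longleftrightarrow> z = f x w" if "x \<in> ?S" for x z w
    using that by (metis bij_inv_eq_iff)
  have S: "GenT \<in> ?S" "GenP \<in> ?S" "\<And>i. 1 \<le> i \<Longrightarrow> i \<le> k \<Longrightarrow> GenA i \<in> ?S"
    by (auto simp: Gamma_gens_def)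
  have eval_conj: "eval_word f (wconj (gen x) (gen GenT)) = eval_word f w"
    if "\<And>y c. f x (f GenT (y, c)) = f GenT (eval_word f w (y, c))" for x w
    using that S by (auto simp: wconj_def winv_def gen_def fun_eq_iff f_inv)
  have eval_comm: "eval_word f (wcomm (gen (GenA i) @ gen GenT) (gen GenP)) = id"
    if i: "1 \<le> i" "i \<le> k" for i
  proof -
    \<comment> \<open>\<open>A i\<close> after \<open>T\<close> is injective and fixes
      \<open>\<psi> 0\<close>, so it preserves the condition under which \<open>GenP\<close>
      switches copies.\<close>
    have "A i (T y) = \<psi> 0 \<longleftrightarrow> y = \<psi> 0" for y
      using A\<psi>[OF i] T\<psi>[of 0] A[OF i] T by (metis add_0 bij_pointE)
    then have "f (GenA i) (f GenT (f GenP z)) = f GenP (f (GenA i) (f GenT z))" for z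
      by (cases z) (auto simp: f_simps)
    then show ?thesis using S i by (auto simp: wcomm_def winv_def gen_def fun_eq_iff f_inv)
  qed
  have f_rel: "eval_word f r = eval_word f s" if "(r, s) \<in> ?R" for r s
    using that unfolding Gamma_rels_def
  proof (elim UnE)
    assume "(r, s) \<in> {(wconj (gen (GenA 1)) (gen GenT), gen (GenA 1))}"
    moreover have "eval_word f (wconj (gen (GenA 1)) (gen GenT)) = eval_word f (gen (GenA 1))"
      by (rule eval_conj) (simp add: gen_def f_simps A1[simplified])
    ultimately show ?thesis by simp
  next
    assume "(r, s) \<in> {(wconj (gen (GenA i)) (gen GenT), gen (GenA i) @ gen (GenA (i - 1))) | i. 1 < i \<and> i \<le> k}"
    moreover have "eval_word f (wconj (gen (GenA i)) (gen GenT)) = eval_word f (gen (GenA i) @ gen (GenA (i - 1)))"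
      if "1 < i" "i \<le> k" for i
      by (rule eval_conj) (use Ai[OF that] in \<open>simp add: gen_def f_simps\<close>)
    ultimately show ?thesis by auto
  next
    assume "(r, s) \<in> {(wcomm (gen (GenA i) @ gen GenT) (gen GenP), []) | i. 1 \<le> i \<and> i \<le> k}"
    then show ?thesis using eval_comm by auto
  qed
  have ne: "?g \<otimes>\<^bsub>?G\<^esub> p \<noteq> p \<otimes>\<^bsub>?G\<^esub> ?g"
  proof
    assume eq: "?g \<otimes>\<^bsub>?G\<^esub> p = p \<otimes>\<^bsub>?G\<^esub> ?g"
    have "cls (?w @ gen GenP) = cls (gen GenP @ ?w)"
      using eq ws by (simp add: cls_append cls_winv cls_carrier a_def b_def t_def p_def m_assoc)
    then have "(?w @ gen GenP, gen GenP @ ?w) \<in> pres_rel ?S ?R" using ws by (subst (asm) cls_eq) auto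
    then have "eval_word f (?w @ gen GenP) = eval_word f (gen GenP @ ?w)"
    proof (rule eval_word_pres_rel)
      show "bij (f x)" if "x \<in> ?S" for x using that bij_f by blast
      show "eval_word f r = eval_word f s" if "(r, s) \<in> ?R" for r s
        using that f_rel by blast
    qed
    \<comment> \<open>The rightmost letter acts first. One side switches the copy at
      \<open>\<psi> 0\<close> and then moves the point; the other first moves it to
      \<open>z\<close>, away from \<open>\<psi> 0\<close>, where \<open>GenP\<close> does nothing.
      So the copies differ.\<close>
    then have "eval_word f (?w @ gen GenP) (\<psi> 0, True) = eval_word f (gen GenP @ ?w) (\<psi> 0, True)"
      by simp
    moreover obtain z where z: "A 2 z = T (A 1 (A 2 (\<psi> 0)))"
      using A[of 2] assms by (metis bij_pointE Suc_1 Suc_leI one_le_numeral)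
    moreover have "z \<noteq> \<psi> 0" using z move by auto
    moreover have "finv (f (GenA 2)) (A 2 z, c) = (z, c)" for c
      using f_inv[of "GenA 2"] S(3)[of 2] assms by (simp add: f_simps)
    ultimately show False
      by (simp add: eval_word_append winv_def gen_def f_simps flip: z)
  qed
  show ?thesis
    by (rule not_residually_finiteI[OF group_Gamma _ _ ne quot]) auto
qed

end
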